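(* A coherence breaking qubit channel may be converted to a non-coherence breaking qubit channel with the help of a quantum switch along with a measurement-based controlled incoherent unitary operation. That is, there exist a coherence breaking qubit channel $\mathcal{E}$, a state $\omega$ of the control qubit, and a measurement-based controlled incoherent unitary operation $\mathcal{U}$ such that the effective qubit channel $$\Gamma_{eff}(\rho)=\mathrm{Tr}_{\mathcal{H}_c}\big[\mathcal{U}\,\mathsf{S}_{\mathcal{E},\mathcal{E},\omega}(\rho)\,\mathcal{U}^\dagger\big]$$ is not coherence breaking, where $\mathcal{H}_c$ is the Hilbert space of the control qubit.
   Context: Coherence is considered with respect to the basis $\{|0\rangle,|1\rangle\}$ (the eigenbasis of $\sigma_z$) of a qubit. A state is incoherent if it is diagonal in this basis. A qubit channel (CPTP map) $\mathcal{E}$ is coherence breaking if $\mathcal{E}(\rho)$ is incoherent for every qubit state $\rho$. An incoherent unitary is a unitary $U$ such that $U\rho U^\dagger$ is incoherent for every incoherent $\rho$. If $\mathcal{E}$ has Kraus operators $\{\mathcal{A}_x\}$, the quantum switch applied to two copies of $\mathcal{E}$ with control qubit state $\omega$ has Kraus operators $\mathsf{S}_{x,y}=\mathcal{A}_x\mathcal{A}_y\otimes|0\rangle\langle 0|+\mathcal{A}_y\mathcal{A}_x\otimes|1\rangle\langle 1|$, i.e. $\mathsf{S}_{\mathcal{E},\mathcal{E},\omega}(\rho)=\sum_{x,y}\mathsf{S}_{x,y}(\rho\otimes\omega)\mathsf{S}_{x,y}^\dagger$. A measurement-based controlled incoherent unitary operation is $\mathcal{U}=U_1\otimes|a\rangle\langle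 a|+U_2\otimes|a^\perp\rangle\langle a^\perp|$, where $\{|a\rangle,|a^\perp\rangle\}$ is an orthonormal basis of the control qubit space and $U_1,U_2$ are incoherent unitaries on the system qubit (implemented by measuring the control qubit in this basis and applying $U_1$ or $U_2$ according to the outcome). *)

theory Defs
  imports "HOL-Analysis.Analysis"
begin

text \<open>
  The state space of a qubit is \<^typ>\<open>complex^2\<close>. The type \<^typ>\<open>2\<close> has exactly the elements
  \<open>1\<close> and \<open>2\<close> (where \<open>2 = 0\<close>); index \<open>1\<close> belongs to \<open>|0\<rangle>\<close> and index \<open>2\<close> to \<open>|1\<rangle>\<close>.
  Operators on the tensor product of two spaces are matrices indexed by pairs, the first component
  belonging to the system and the second one to the control.
\<close>

type_synonym 'n cop = "complex^'n^'n"

definition ket0 :: "complex^2" where "ket0 = axis 1 1"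
definition ket1 :: "complex^2" where "ket1 = axis 2 1"

definition cip :: "complex^'n \<Rightarrow> complex^'n \<Rightarrow> complex" where
  "cip u v = (\<Sum>i\<in>UNIV. cnj (u $ i) * v $ i)"

definition dagger :: "complex^'n^'m \<Rightarrow> complex^'m^'n"  ("_\<^sup>\<dagger>" [1000] 999) where
  "A\<^sup>\<dagger> = (\<chi> i j. cnj (A $ j $ i))"

definition outer :: "complex^'n \<Rightarrow> complex^'n \<Rightarrow> 'n::finite cop" where
  "outer u v = (\<chi> i j. u $ i * cnj (v $ j))"

definition cmscale :: "complex \<Rightarrow> 'n::finite cop \<Rightarrow> 'n cop" where
  "cmscale c A = (\<chi> i j. c * A $ i $ j)"

definition tensor :: "'n::finite cop \<Rightarrow> 'm::finite cop \<Rightarrow> ('n \<times> 'm) cop"  (infixl "\<otimes>" 75) where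
  "A \<otimes> B = (\<chi> p q. A $ fst p $ fst q * B $ snd p $ snd q)"

definition ptrace_control :: "('n::finite \<times> 'm::finite) cop \<Rightarrow> 'n cop" where
  "ptrace_control M = (\<chi> i k. \<Sum>j\<in>UNIV. M $ (i, j) $ (k, j))"

definition positive_op :: "'n::finite cop \<Rightarrow> bool" where
  "positive_op A \<longleftrightarrow> (\<forall>v. cip v (A *v v) \<in> \<real>\<^sub>\<ge>\<^sub>0)"

definition is_state :: "'n::finite cop \<Rightarrow> bool" where
  "is_state \<rho> \<longleftrightarrow> positive_op \<rho> \<and> trace \<rho> = 1"

definition unitary_op :: "'n::finite cop \<Rightarrow> bool" where
  "unitary_op U \<longleftrightarrow> U\<^sup>\<dagger> ** U = mat 1 \<and> U ** U\<^sup>\<dagger> = mat 1"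

definition clinear_map :: "('n::finite cop \<Rightarrow> 'n cop) \<Rightarrow> bool" where
  "clinear_map \<Phi> \<longleftrightarrow>
     (\<forall>A B. \<Phi> (A + B) = \<Phi> A + \<Phi> B) \<and> (\<forall>c A. \<Phi> (cmscale c A) = cmscale c (\<Phi> A))"

text \<open>
  Complete positivity asks that \<open>id\<^sub>k \<otimes> \<Phi>\<close> be positive for every \<open>k\<close>. An operator on
  \<open>\<complex>\<^sup>k \<otimes> H\<close> is encoded as a \<open>k \<times> k\<close> block matrix \<open>X\<close> whose blocks \<open>X i j\<close> (for \<open>i, j < k\<close>) are
  operators on \<open>H\<close>, and \<open>id\<^sub>k \<otimes> \<Phi>\<close> acts by applying \<open>\<Phi>\<close> to every block.
\<close>

definition positive_block :: "nat \<Rightarrow> (nat \<Rightarrow> nat \<Rightarrow> 'n::finite cop) \<Rightarrow> bool" where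
  "positive_block k X \<longleftrightarrow>
     (\<forall>v :: nat \<Rightarrow> complex^'n. (\<Sum>i<k. \<Sum>j<k. cip (v i) (X i j *v v j)) \<in> \<real>\<^sub>\<ge>\<^sub>0)"

definition completely_positive :: "('n::finite cop \<Rightarrow> 'n cop) \<Rightarrow> bool" where
  "completely_positive \<Phi> \<longleftrightarrow>
     (\<forall>k X. positive_block k X \<longrightarrow> positive_block k (\<lambda>i j. \<Phi> (X i j)))"

definition trace_preserving :: "('n::finite cop \<Rightarrow> 'n cop) \<Rightarrow> bool" where
  "trace_preserving \<Phi> \<longleftrightarrow> (\<forall>A. trace (\<Phi> A) = trace A)"

definition qubit_channel :: "(2 cop \<Rightarrow> 2 cop) \<Rightarrow> bool" where
  "qubit_channel \<Phi> \<longleftrightarrow> clinear_map \<Phi> \<and> completely_positive \<Phi> \<and> trace_preserving \<Phi>"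

definition has_kraus :: "(2 cop \<Rightarrow> 2 cop) \<Rightarrow> nat \<Rightarrow> (nat \<Rightarrow> 2 cop) \<Rightarrow> bool" where
  "has_kraus \<Phi> n A \<longleftrightarrow> (\<forall>\<rho>. \<Phi> \<rho> = (\<Sum>x<n. A x ** \<rho> ** (A x)\<^sup>\<dagger>))"

definition incoherent_state :: "2 cop \<Rightarrow> bool" where
  "incoherent_state \<rho> \<longleftrightarrow> is_state \<rho> \<and> (\<forall>i j. i \<noteq> j \<longrightarrow> \<rho> $ i $ j = 0)"

definition coherence_breaking :: "(2 cop \<Rightarrow> 2 cop) \<Rightarrow> bool" where
  "coherence_breaking \<Phi> \<longleftrightarrow> (\<forall>\<rho>. is_state \<rho> \<longrightarrow> incoherent_state (\<Phi> \<rho>))"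

definition incoherent_unitary :: "2 cop \<Rightarrow> bool" where
  "incoherent_unitary U \<longleftrightarrow>
     unitary_op U \<and> (\<forall>\<rho>. incoherent_state \<rho> \<longrightarrow> incoherent_state (U ** \<rho> ** U\<^sup>\<dagger>))"

definition orthonormal_pair :: "complex^2 \<Rightarrow> complex^2 \<Rightarrow> bool" where
  "orthonormal_pair a b \<longleftrightarrow> cip a a = 1 \<and> cip b b = 1 \<and> cip a b = 0"

definition switch_kraus :: "(nat \<Rightarrow> 2 cop) \<Rightarrow> nat \<Rightarrow> nat \<Rightarrow> (2 \<times> 2) cop" where
  "switch_kraus A x y =
     (A x ** A y) \<otimes> outer ket0 ket0 + (A y ** A x) \<otimes> outer ket1 ket1"

definition quantum_switch :: "nat \<Rightarrow> (nat \<Rightarrow> 2 cop) \<Rightarrow> 2 cop \<Rightarrow> 2 cop \<Rightarrow> (2 \<times> 2) cop" where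
  "quantum_switch n A \<omega> \<rho> =
     (\<Sum>x<n. \<Sum>y<n. switch_kraus A x y ** (\<rho> \<otimes> \<omega>) ** (switch_kraus A x y)\<^sup>\<dagger>)"

definition mb_controlled_incoherent_unitary :: "(2 \<times> 2) cop \<Rightarrow> bool" where
  "mb_controlled_incoherent_unitary V \<longleftrightarrow>
     (\<exists>U1 U2 a b. incoherent_unitary U1 \<and> incoherent_unitary U2 \<and> orthonormal_pair a b \<and>
        V = U1 \<otimes> outer a a + U2 \<otimes> outer b b)"

definition effective_channel ::
    "nat \<Rightarrow> (nat \<Rightarrow> 2 cop) \<Rightarrow> 2 cop \<Rightarrow> (2 \<times> 2) cop \<Rightarrow> 2 cop \<Rightarrow> 2 cop" where
  "effective_channel n A \<omega> V \<rho> = ptrace_control (V ** quantum_switch n A \<omega> \<rho> ** V\<^sup>\<dagger>)"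

end

theory Submission
  imports Defs
begin

text \<open>
  Take the Kraus operators \<open>|0\<rangle>\<langle>1|\<close> and \<open>|1\<rangle>\<langle>0|\<close>, which erase all off-diagonal entries. Their
  squares vanish and their two products are \<open>|0\<rangle>\<langle>0|\<close> and \<open>|1\<rangle>\<langle>1|\<close>, so that the two nonzero Kraus
  operators of the switch are the projections onto the even and onto the odd parity subspace of
  system and control. For \<open>\<omega> = |+\<rangle>\<langle>+|\<close> the off-diagonal entries of \<open>\<rho>\<close> survive in the control
  off-diagonal blocks. The operation \<open>1 \<otimes> |+\<rangle>\<langle>+| + \<sigma>\<^sub>z \<otimes> |-\<rangle>\<langle>-|\<close> is the CNOT gate with target
  the control qubit; it moves the parity into the control qubit, which turns the effective channel
  into the identity.
\<close>

lemma cip_dagger: "cip v (A *v w) = cip (A\<^sup>\<dagger> *v v) w"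
proof -
  have "cip v (A *v w) = (\<Sum>i\<in>UNIV. \<Sum>j\<in>UNIV. cnj (v $ i) * (A $ i $ j * w $ j))"
    by (simp add: cip_def matrix_vector_mult_def sum_distrib_left)
  also have "\<dots> = (\<Sum>j\<in>UNIV. \<Sum>i\<in>UNIV. cnj (v $ i) * (A $ i $ j * w $ j))"
    by (rule sum.swap)
  also have "\<dots> = cip (A\<^sup>\<dagger> *v v) w"
    by (simp add: cip_def matrix_vector_mult_def dagger_def sum_distrib_left mult_ac)
  finally show ?thesis .
qed

lemma cip_add_right: "cip v (w + w') = cip v w + cip v w'"
  by (simp add: cip_def algebra_simps sum.distrib)

text \<open>Moving \<open>A\<close> across the inner product replaces each test vector
  \<open>v i\<close> by \<open>A\<^sup>\<dagger> *v v i\<close>, and positivity of the block matrix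
  was assumed for all families of vectors.\<close>

lemma completely_positive_conj: "completely_positive (\<lambda>\<rho>. A ** \<rho> ** A\<^sup>\<dagger>)"
proof -
  have "cip v (A ** M ** A\<^sup>\<dagger> *v w) = cip (A\<^sup>\<dagger> *v v) (M *v (A\<^sup>\<dagger> *v w))" for M v w
    by (metis cip_dagger matrix_vector_mul_assoc)
  then show ?thesis
    by (simp add: completely_positive_def positive_block_def)
qed

lemma completely_positive_add:
  assumes "completely_positive \<Phi>" "completely_positive \<Psi>"
  shows "completely_positive (\<lambda>\<rho>. \<Phi> \<rho> + \<Psi> \<rho>)"
  using assms unfolding completely_positive_def positive_block_def
  by (simp add: matrix_vector_mult_add_rdistrib cip_add_right sum.distrib nonneg_Reals_add_I)

lemma clinear_map_conj: "clinear_map (\<lambda>\<rho>. A ** \<rho> ** A\<^sup>\<dagger>)"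
  unfolding clinear_map_def
proof (intro conjI allI)
  show "A ** (B + C) ** A\<^sup>\<dagger> = A ** B ** A\<^sup>\<dagger> + A ** C ** A\<^sup>\<dagger>" for B C
    by (simp add: matrix_add_ldistrib matrix_matrix_mult_def vec_eq_iff algebra_simps sum.distrib)
  show "A ** cmscale c B ** A\<^sup>\<dagger> = cmscale c (A ** B ** A\<^sup>\<dagger>)" for c B
    by (simp add: cmscale_def matrix_matrix_mult_def vec_eq_iff sum_distrib_left mult_ac)
qed

lemma clinear_map_add:
  assumes "clinear_map \<Phi>" "clinear_map \<Psi>"
  shows "clinear_map (\<lambda>\<rho>. \<Phi> \<rho> + \<Psi> \<rho>)"
  using assms by (simp add: clinear_map_def cmscale_def vec_eq_iff algebra_simps)

text \<open>Ordinary positivity is the case of a single block.\<close>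

lemma completely_positive_imp_positive_op:
  assumes "completely_positive \<Phi>" "positive_op \<rho>"
  shows "positive_op (\<Phi> \<rho>)"
proof -
  have "positive_block 1 (\<lambda>i j. \<rho>)"
    using assms(2) by (simp add: positive_block_def positive_op_def)
  then have *: "positive_block 1 (\<lambda>i j. \<Phi> \<rho>)"
    using assms(1) unfolding completely_positive_def by blast
  show ?thesis unfolding positive_op_def
  proof
    fix v
    show "cip v (\<Phi> \<rho> *v v) \<in> \<real>\<^sub>\<ge>\<^sub>0"
      using *[unfolded positive_block_def, rule_format, of "\<lambda>_. v"] by simp
  qed
qed

lemma qubit_channel_is_state: "qubit_channel \<Phi> \<Longrightarrow> is_state \<rho> \<Longrightarrow> is_state (\<Phi> \<rho>)"
  by (simp add: qubit_channel_def is_state_def trace_preserving_def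
      completely_positive_imp_positive_op)

lemma qubit_channel_id: "qubit_channel (\<lambda>\<rho>. \<rho>)"
  by (simp add: qubit_channel_def clinear_map_def completely_positive_def trace_preserving_def)

text \<open>The quadratic form at \<open>v\<close> is the squared modulus of \<open>cip v a\<close>,
  and the trace is the squared norm of \<open>a\<close>.\<close>

lemma is_state_outer:
  assumes "cip a a = 1"
  shows "is_state (outer a a)"
proof -
  have "cip v (outer a a *v v) = cip v a * cnj (cip v a)" for v
    unfolding cip_def outer_def matrix_vector_mult_def
    by (simp add: sum_product sum_distrib_left mult_ac) (rule sum.swap)
  then have "cip v (outer a a *v v) \<in> \<real>\<^sub>\<ge>\<^sub>0" for v
    by (simp flip: complex_norm_square)
  moreover have "trace (outer a a) = 1"
    using assms by (simp add: trace_def outer_def cip_def mult_ac)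
  ultimately show ?thesis
    by (simp add: is_state_def positive_op_def)
qed

lemma matrix2_eq_iff: "(M :: 'a^2^2) = N \<longleftrightarrow>
    M $ 1 $ 1 = N $ 1 $ 1 \<and> M $ 1 $ 2 = N $ 1 $ 2 \<and> M $ 2 $ 1 = N $ 2 $ 1 \<and> M $ 2 $ 2 = N $ 2 $ 2"
  by (auto simp: vec_eq_iff forall_2)

lemma sum_UNIV_prod:
  "(\<Sum>p\<in>(UNIV :: ('a::finite \<times> 'b::finite) set). f p) = (\<Sum>i\<in>UNIV. \<Sum>j\<in>UNIV. f (i, j))"
  by (simp add: sum.cartesian_product flip: UNIV_Times_UNIV)

definition ket_plus :: "complex^2" where "ket_plus = (\<chi> i. 1 / sqrt 2)"
definition ket_minus :: "complex^2" where "ket_minus = (\<chi> i. if i = 1 then 1 / sqrt 2 else - 1 / sqrt 2)"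

definition pauli_z :: "2 cop" where
  "pauli_z = (\<chi> i j. if i = j then if i = 1 then 1 else - 1 else 0)"

lemma sqrt2_sq: "complex_of_real (sqrt 2) * complex_of_real (sqrt 2) = 2"
  by (simp flip: of_real_mult)

lemma orthonormal_pair_plus_minus: "orthonormal_pair ket_plus ket_minus"
  by (simp add: orthonormal_pair_def cip_def ket_plus_def ket_minus_def sum_2 sqrt2_sq)

lemma outer_ket_plus: "outer ket_plus ket_plus = (\<chi> i j. 1 / 2)"
  by (simp add: outer_def ket_plus_def sqrt2_sq vec_eq_iff)

lemma outer_ket_minus: "outer ket_minus ket_minus = (\<chi> i j. if i = j then 1 / 2 else - 1 / 2)"
  by (simp add: outer_def ket_minus_def sqrt2_sq matrix2_eq_iff)

lemma incoherent_unitary_one: "incoherent_unitary (mat 1)"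
proof -
  have "(mat 1 :: 2 cop)\<^sup>\<dagger> = mat 1"
    by (simp add: dagger_def mat_def matrix2_eq_iff)
  then show ?thesis
    by (simp add: incoherent_unitary_def unitary_op_def)
qed

lemma incoherent_unitary_pauli_z: "incoherent_unitary pauli_z"
proof -
  have "pauli_z\<^sup>\<dagger> = pauli_z"
    by (simp add: dagger_def pauli_z_def matrix2_eq_iff)
  moreover have "pauli_z ** pauli_z = mat 1"
    by (simp add: pauli_z_def mat_def matrix_matrix_mult_def sum_2 matrix2_eq_iff)
  \<comment> \<open>Conjugation by \<open>pauli_z\<close> only flips the sign of the off-diagonal
    entries, and these vanish here.\<close>
  moreover have "pauli_z ** \<rho> ** pauli_z = \<rho>" if "incoherent_state \<rho>" for \<rho>
    using that
    by (simp add: incoherent_state_def pauli_z_def matrix_matrix_mult_def sum_2 matrix2_eq_iff)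
  ultimately show ?thesis
    by (simp add: incoherent_unitary_def unitary_op_def)
qed

definition flip_kraus :: "nat \<Rightarrow> 2 cop" where
  "flip_kraus x = (if x = 0 then outer ket0 ket1 else outer ket1 ket0)"

definition flip_channel :: "2 cop \<Rightarrow> 2 cop" where
  "flip_channel \<rho> = (\<Sum>x<2. flip_kraus x ** \<rho> ** (flip_kraus x)\<^sup>\<dagger>)"

lemma flip_channel_conj:
  "flip_channel \<rho> =
     flip_kraus 0 ** \<rho> ** (flip_kraus 0)\<^sup>\<dagger> + flip_kraus 1 ** \<rho> ** (flip_kraus 1)\<^sup>\<dagger>"
  by (simp add: flip_channel_def numeral_2_eq_2)

text \<open>Each Kraus operator moves one diagonal entry to the other diagonal position and discards
  the rest, so the channel is complete dephasing followed by a bit flip.\<close>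

lemma flip_channel_eq:
  "flip_channel \<rho> = (\<chi> i j. if i = j then if i = 1 then \<rho> $ 2 $ 2 else \<rho> $ 1 $ 1 else 0)"
  by (simp add: flip_channel_conj flip_kraus_def outer_def ket0_def ket1_def axis_def dagger_def
      matrix_matrix_mult_def sum_2 matrix2_eq_iff)

lemma qubit_channel_flip: "qubit_channel flip_channel"
proof -
  have "clinear_map flip_channel" "completely_positive flip_channel"
    \<comment> \<open>As a sum of two conjugations the channel matches the closure rules.\<close>
    unfolding flip_channel_conj [abs_def]
    by (intro clinear_map_add clinear_map_conj completely_positive_add completely_positive_conj)+
  then show ?thesis
    by (simp add: qubit_channel_def trace_preserving_def trace_def sum_2 flip_channel_eq)
qed

lemma coherence_breaking_flip: "coherence_breaking flip_channel"
  using qubit_channel_is_state [OF qubit_channel_flip]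
  by (simp add: coherence_breaking_def incoherent_state_def flip_channel_eq)

text \<open>Every nonzero index stands for the same operator, so only whether an index is 0 matters.
  The case \<open>x = 0\<close> gives the even projection.\<close>

lemma switch_kraus_flip:
  "switch_kraus flip_kraus x y =
     (if (x = 0) = (y = 0) then 0
      else \<chi> p q. if p = q \<and> (fst p = snd p) = (x = 0) then 1 else 0)"
  by (simp add: switch_kraus_def flip_kraus_def tensor_def outer_def ket0_def ket1_def axis_def
      matrix_matrix_mult_def sum_2 vec_eq_iff forall_2)

text \<open>Summing the sandwiches by the two parity projections keeps exactly the entries whose row
  and column agree in parity; the factor 1/2 is the constant entry of
  \<open>\<omega>\<close>.\<close>

lemma quantum_switch_flip:
  "quantum_switch 2 flip_kraus (outer ket_plus ket_plus) \<rho> =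
     (\<chi> p q. if (fst p = snd p) = (fst q = snd q) then \<rho> $ fst p $ fst q / 2 else 0)"
  by (simp add: quantum_switch_def numeral_2_eq_2 switch_kraus_flip outer_ket_plus tensor_def
      dagger_def matrix_matrix_mult_def sum_UNIV_prod sum_2 vec_eq_iff forall_2)

definition parity_gate :: "(2 \<times> 2) cop" where
  "parity_gate = mat 1 \<otimes> outer ket_plus ket_plus + pauli_z \<otimes> outer ket_minus ket_minus"

text \<open>On system state 0 the control sees the sum of the two projections, the identity; on
  system state 1 it sees their difference, the bit flip.\<close>

lemma parity_gate_eq:
  "parity_gate = (\<chi> p q. if fst p = fst q \<and> (snd p = snd q) = (fst p = 1) then 1 else 0)"
  by (simp add: parity_gate_def outer_ket_plus outer_ket_minus pauli_z_def mat_def tensor_def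
      vec_eq_iff forall_2)

lemma mb_controlled_incoherent_unitary_parity_gate:
  "mb_controlled_incoherent_unitary parity_gate"
  unfolding mb_controlled_incoherent_unitary_def parity_gate_def
  using incoherent_unitary_one incoherent_unitary_pauli_z orthonormal_pair_plus_minus by blast

text \<open>The gate turns equal parity of row and column into equal control index. The joint
  operator becomes \<open>\<rho>\<close> tensored with half the identity, and the partial trace
  returns \<open>\<rho>\<close>.\<close>

lemma effective_channel_flip:
  "effective_channel 2 flip_kraus (outer ket_plus ket_plus) parity_gate = (\<lambda>\<rho>. \<rho>)"
  by (simp add: fun_eq_iff effective_channel_def quantum_switch_flip parity_gate_eq dagger_def
      ptrace_control_def matrix_matrix_mult_def sum_UNIV_prod sum_2 matrix2_eq_iff)

lemma not_coherence_breaking_id: "\<not> coherence_breaking (\<lambda>\<rho>. \<rho>)"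
proof -
  have "is_state (outer ket_plus ket_plus)"
    using orthonormal_pair_plus_minus by (simp add: is_state_outer orthonormal_pair_def)
  \<comment> \<open>Its off-diagonal entries are 1/2.\<close>
  moreover have "\<not> incoherent_state (outer ket_plus ket_plus)"
    by (simp add: incoherent_state_def outer_ket_plus forall_2)
  ultimately show ?thesis
    by (auto simp: coherence_breaking_def)
qed

theorem theorem5:
  "\<exists>(E :: 2 cop \<Rightarrow> 2 cop) (n :: nat) (A :: nat \<Rightarrow> 2 cop) (\<omega> :: 2 cop) (V :: (2 \<times> 2) cop).
     qubit_channel E \<and> coherence_breaking E \<and> has_kraus E n A \<and>
     is_state \<omega> \<and> mb_controlled_incoherent_unitary V \<and>
     qubit_channel (effective_channel n A \<omega> V) \<and>
     \<not> coherence_breaking (effective_channel n A \<omega> V)"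
proof (intro exI conjI)
  show "qubit_channel flip_channel"
    by (rule qubit_channel_flip)
  show "coherence_breaking flip_channel"
    by (rule coherence_breaking_flip)
  show "has_kraus flip_channel 2 flip_kraus"
    by (simp add: has_kraus_def flip_channel_def)
  show "is_state (outer ket_plus ket_plus)"
    using orthonormal_pair_plus_minus by (simp add: is_state_outer orthonormal_pair_def)
  show "mb_controlled_incoherent_unitary parity_gate"
    by (rule mb_controlled_incoherent_unitary_parity_gate)
  show "qubit_channel (effective_channel 2 flip_kraus (outer ket_plus ket_plus) parity_gate)"
    by (simp add: effective_channel_flip qubit_channel_id)
  show "\<not> coherence_breaking (effective_channel 2 flip_kraus (outer ket_plus ket_plus) parity_gate)"
    by (simp add: effective_channel_flip not_coherence_breaking_id)
qed

end
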